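(* Suppose that the radial sampling density $q:\mathbb{R}^d\to(0,\infty)$ has subexponential decay. Then with high probability the random geometric graph $G(\mathcal{P}_n,1)$ is disconnected, i.e. $\lim_{n\to\infty}\mathbb{P}(G(\mathcal{P}_n,1)\text{ is disconnected})=1$.
   Context: Let $d\ge 2$ and let $\nu$ be a probability measure on $\mathbb{R}^d$ with density $q:\mathbb{R}^d\to(0,\infty)$ that is radial, i.e. $q(x)$ depends only on $|x|$; the radial profile (a function on $(0,\infty)$) is also denoted $q$. $\mathcal{P}_n$ is the Poisson point process of intensity $n\nu$: $\mathcal{P}_n=\{x_1,\dots,x_N\}$ with $N\sim \mathrm{Po}(n)$ independent of the $x_i$, which are i.i.d. with law $\nu$. For $r>0$, $G(\mathcal{P}_n,r)$ is the graph with vertex set $\mathcal{P}_n$ in which two distinct points are joined by an edge iff their Euclidean distance is less than $r$. A function $f:(0,\infty)\to(0,\infty)$ is regularly varying with exponent $\alpha\in\mathbb{R}$, written $f\in RV_\alpha$, if $\lim_{R\to\infty} f(tR)/f(R)=t^\alpha$ for all $t>0$. A radial density $q$ has a heavy tail if there is $\alpha>d$ such that (the radial profile of) $q$ lies in $RV_{-\alpha}$. A function $\psi\in C^2([0,\infty);[0,\infty))$ is of von Mises type if $\psi'(z)>0$ for all sufficiently large $z$, $\psi(z)\to\infty$ as $z\to\infty$, and $a'(z)\to 0$ as $z\to\infty$, where $a(z):=1/\psi'(z)$. A radial density $q$ has a light tail if it can be written as $q(x)=L(|x|)\exp(-\psi(|x|))$ where $\psi\in C^2([0,\infty);[0,\infty))$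 is of von Mises type, $\psi'$ is eventually monotone, and $L\in RV_\alpha$ for some $\alpha\in\mathbb{R}$. The density $q$ has subexponential decay if either it has a heavy tail, or it has a light tail with $\psi\in RV_v$ for some $v\in(0,1)$. *)

theory Defs
  imports
    "Graph_Theory.Digraph_Component"
    "HOL-Probability.Probability"
begin

text \<open>A Poisson point process of intensity \<open>t \<cdot> \<nu>\<close> with \<open>\<nu>\<close> a probability measure on
  the Borel sets, as a random finite set \<open>P\<close> defined on the probability space \<open>M\<close>: the sample size
  \<open>N\<close> is Poisson distributed with parameter \<open>t\<close>, the points \<open>X i\<close> are i.i.d. with law \<open>\<nu>\<close>, and
  \<open>N\<close> is independent of the whole sequence of points (\<^const>\<open>prob_space.indep_var\<close> would need both
  variables to have the same type).  The library's \<^const>\<open>poisson_pmf\<close> is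
  only specified for a positive rate, hence \<open>t > 0\<close>.\<close>

definition poisson_point_process ::
  "'w measure \<Rightarrow> real \<Rightarrow> 'a::euclidean_space measure \<Rightarrow> ('w \<Rightarrow> 'a set) \<Rightarrow> bool" where
  "poisson_point_process M t \<nu> P \<longleftrightarrow> prob_space M \<and> t > 0 \<and>
     (\<exists>(N :: 'w \<Rightarrow> nat) (X :: nat \<Rightarrow> 'w \<Rightarrow> 'a).
        N \<in> measurable M (count_space UNIV) \<and>
        distr M (count_space UNIV) N = measure_pmf (poisson_pmf t) \<and>
        (\<forall>i. X i \<in> borel_measurable M \<and> distr M borel (X i) = \<nu>) \<and>
        prob_space.indep_vars M (\<lambda>_. borel) X UNIV \<and>
        prob_space.indep_set M
          {N -` A \<inter> space M | A. A \<in> sets (count_space UNIV)}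
          {(\<lambda>\<omega> i. X i \<omega>) -` B \<inter> space M | B. B \<in> sets (PiM UNIV (\<lambda>_. borel))} \<and>
        (\<forall>\<omega>\<in>space M. P \<omega> = (\<lambda>i. X i \<omega>) ` {..<N \<omega>}))"

text \<open>Undirected graphs are symmetric digraphs, as usual in the graph library.\<close>

definition geometric_graph :: "'a::metric_space set \<Rightarrow> real \<Rightarrow> ('a, 'a \<times> 'a) pre_digraph" where
  "geometric_graph V r =
     \<lparr> verts = V, arcs = {(x, y). x \<in> V \<and> y \<in> V \<and> x \<noteq> y \<and> dist x y < r}, tail = fst, head = snd \<rparr>"

text \<open>The name \<open>connected\<close> alone denotes topological connectedness here.  The graph-theoretic
  notion regards the graph without vertices as not connected; in a Poisson process of
  total intensity \<open>n\<close> this case has probability \<open>exp (- n)\<close>, so it does not affect limits.\<close>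

definition disconnected_graph :: "('a, 'b) pre_digraph \<Rightarrow> bool" where
  "disconnected_graph G \<longleftrightarrow> \<not> Digraph_Component.connected G"

definition regularly_varying :: "real \<Rightarrow> (real \<Rightarrow> real) \<Rightarrow> bool" where
  "regularly_varying \<alpha> f \<longleftrightarrow>
     (\<forall>x>0. f x > 0) \<and> (\<forall>t>0. ((\<lambda>R. f (t * R) / f R) \<longlongrightarrow> t powr \<alpha>) at_top)"

definition radial :: "('a::real_normed_vector \<Rightarrow> 'b) \<Rightarrow> bool" where
  "radial q \<longleftrightarrow> (\<forall>x y. norm x = norm y \<longrightarrow> q x = q y)"

text \<open>For radial \<open>q\<close> and \<open>r \<ge> 0\<close> the value does not depend on the chosen point of norm \<open>r\<close>.\<close>

definition radial_profile :: "('a::real_normed_vector \<Rightarrow> real) \<Rightarrow> real \<Rightarrow> real" where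
  "radial_profile q r = q (SOME x. norm x = r)"

definition heavy_tail :: "('a::euclidean_space \<Rightarrow> real) \<Rightarrow> bool" where
  "heavy_tail q \<longleftrightarrow> (\<exists>\<alpha>. \<alpha> > real DIM('a) \<and> regularly_varying (- \<alpha>) (radial_profile q))"

text \<open>\<open>C\<^sup>2([0,\<infinity>))\<close>, with one-sided derivatives at \<open>0\<close>.\<close>

definition C2_on_nonneg :: "(real \<Rightarrow> real) \<Rightarrow> bool" where
  "C2_on_nonneg \<psi> \<longleftrightarrow> (\<exists>\<psi>1 \<psi>2.
     (\<forall>z\<ge>0. (\<psi> has_real_derivative \<psi>1 z) (at z within {0..})) \<and>
     (\<forall>z\<ge>0. (\<psi>1 has_real_derivative \<psi>2 z) (at z within {0..})) \<and>
     continuous_on {0..} \<psi>2)"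

text \<open>Only the behaviour of the derivatives for large \<open>z\<close> matters below, where
  \<^const>\<open>deriv\<close> is a genuine derivative.\<close>

definition von_mises :: "(real \<Rightarrow> real) \<Rightarrow> bool" where
  "von_mises \<psi> \<longleftrightarrow>
     C2_on_nonneg \<psi> \<and> (\<forall>z\<ge>0. \<psi> z \<ge> 0) \<and>
     (\<forall>\<^sub>F z in at_top. deriv \<psi> z > 0) \<and>
     filterlim \<psi> at_top at_top \<and>
     (deriv (\<lambda>z. 1 / deriv \<psi> z) \<longlongrightarrow> 0) at_top"

definition light_tail_with ::
  "('a::euclidean_space \<Rightarrow> real) \<Rightarrow> (real \<Rightarrow> real) \<Rightarrow> (real \<Rightarrow> real) \<Rightarrow> bool" where
  "light_tail_with q L \<psi> \<longleftrightarrow>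
     (\<forall>x. q x = L (norm x) * exp (- \<psi> (norm x))) \<and>
     von_mises \<psi> \<and>
     (\<exists>z0. mono_on {z0..} (deriv \<psi>) \<or> antimono_on {z0..} (deriv \<psi>)) \<and>
     (\<exists>\<alpha>. regularly_varying \<alpha> L)"

text \<open>Positivity of \<open>\<psi>\<close> on \<open>(0,\<infinity>)\<close>, which is part of \<open>regularly_varying v \<psi>\<close>, is no loss:
  \<open>\<psi>\<close> and \<open>L\<close> may be replaced by \<open>\<psi> + 1\<close> and \<open>exp 1 \<cdot> L\<close>.\<close>

definition subexponential_decay :: "('a::euclidean_space \<Rightarrow> real) \<Rightarrow> bool" where
  "subexponential_decay q \<longleftrightarrow>
     heavy_tail q \<or>
     (\<exists>L \<psi> v. light_tail_with q L \<psi> \<and> 0 < v \<and> v < 1 \<and> regularly_varying v \<psi>)"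

end

theory Submission
  imports Defs
begin

text \<open>Subexponential decay makes the density locally comparable: \<open>q x \<le> C * q y\<close> for all \<open>x\<close>, \<open>y\<close> far out
  whose norms differ by at most 2. Hence for large \<open>n\<close> there is a radius \<open>k\<close>, tending to infinity, at which
  \<open>n * q\<close> is of order 1. On the sphere of radius \<open>k\<close> one finds, since the dimension is at least 2,
  arbitrarily many centres at mutual distance at least 4. Each centre \<open>z\<close> independently has a probability bounded
  away from 0 that \<open>ball z (1 / 2)\<close> contains a point of the process while the rest of
  \<open>ball z (3 / 2)\<close> contains none. As soon as two centres have this property, the graph is disconnected.\<close>

section \<open>Cuts of geometric graphs\<close>

lemma rtrancl_on_cut:
  assumes "(u, v) \<in> rtrancl_on F E" "u \<in> S" "\<And>x y. (x, y) \<in> E \<Longrightarrow> x \<in> S \<Longrightarrow> y \<in> F \<Longrightarrow> y \<in> S"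
  shows "v \<in> S"
  using assms(1) by (induction rule: rtrancl_on_induct) (use assms(2,3) in auto)

text \<open>The points reachable from a fixed vertex form a cut, and conversely no path leaves one
  side of a cut. This trades reachability for plain distance conditions, which serve both
  measurability and the isolated cells. The case \<open>V = {}\<close> comes from the convention
  that the empty graph is not connected.\<close>

lemma disconnected_geometric_graph_iff:
  "disconnected_graph (geometric_graph V r) \<longleftrightarrow>
     V = {} \<or> (\<exists>S\<subseteq>V. S \<noteq> {} \<and> S \<noteq> V \<and> (\<forall>x\<in>S. \<forall>y\<in>V - S. r \<le> dist x y))"
  (is "_ \<longleftrightarrow> V = {} \<or> ?cut")
proof -
  let ?G = "with_proj (mk_symmetric (geometric_graph V r))"
  define E where "E = {(x, y). x \<in> V \<and> y \<in> V \<and> x \<noteq> y \<and> dist x y < r}"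
  \<comment> \<open>Adjacency is symmetric because \<open>dist\<close> is, so the symmetric closure
    taken by the library adds no arcs.\<close>
  have E: "arcs_ends ?G = E" "verts ?G = V" "verts (geometric_graph V r) = V"
    by (auto simp: arcs_ends_def arc_to_ends_def parcs_mk_symmetric geometric_graph_def E_def
        dist_commute image_iff)
  have conn: "disconnected_graph (geometric_graph V r) \<longleftrightarrow>
      V = {} \<or> (\<exists>u\<in>V. \<exists>v\<in>V. (u, v) \<notin> rtrancl_on V E)"
    unfolding disconnected_graph_def Digraph_Component.connected_def strongly_connected_def
      reachable_def E by blast
  have reach_cut: "?cut" if "u \<in> V" "v \<in> V" "(u, v) \<notin> rtrancl_on V E" for u v
  proof (intro exI[of _ "{w. (u, w) \<in> rtrancl_on V E}"] conjI ballI)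
    show "{w. (u, w) \<in> rtrancl_on V E} \<subseteq> V"
      by (auto dest: in_rtrancl_on_in_F)
    fix x y assume xy: "x \<in> {w. (u, w) \<in> rtrancl_on V E}" "y \<in> V - {w. (u, w) \<in> rtrancl_on V E}"
    show "r \<le> dist x y"
    proof (rule ccontr)
      assume "\<not> r \<le> dist x y"
      with xy have "(x, y) \<in> E"
        by (auto simp: E_def dest: in_rtrancl_on_in_F)
      with xy show False
        by (auto intro: rtrancl_on_into_rtrancl_on)
    qed
  qed (use that in auto)
  have cut_reach: "\<exists>u\<in>V. \<exists>v\<in>V. (u, v) \<notin> rtrancl_on V E"
    if S: "S \<subseteq> V" "S \<noteq> {}" "S \<noteq> V" "\<forall>x\<in>S. \<forall>y\<in>V - S. r \<le> dist x y" for S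
  proof -
    obtain u v where uv: "u \<in> S" "v \<in> V - S" using S by blast
    have "(u, v) \<notin> rtrancl_on V E"
    proof
      assume "(u, v) \<in> rtrancl_on V E"
      then have "v \<in> S"
        by (rule rtrancl_on_cut) (use uv S in \<open>force simp: E_def\<close>)+
      with uv show False by auto
    qed
    with uv S show ?thesis by blast
  qed
  have "(\<exists>u\<in>V. \<exists>v\<in>V. (u, v) \<notin> rtrancl_on V E) \<longleftrightarrow> ?cut"
  proof
    assume "\<exists>u\<in>V. \<exists>v\<in>V. (u, v) \<notin> rtrancl_on V E"
    then show ?cut by (elim bexE) (rule reach_cut)
  next
    assume ?cut
    then show "\<exists>u\<in>V. \<exists>v\<in>V. (u, v) \<notin> rtrancl_on V E"
      by (elim exE conjE) (rule cut_reach)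
  qed
  then show ?thesis
    unfolding conn by (rule arg_cong)
qed

text \<open>A cut of the points is pulled back to a cut of the indices. The family of candidate sets
  \<open>J\<close> then no longer depends on the random positions, and for a finite \<open>I\<close>
  it is finite.\<close>

lemma disconnected_geometric_graph_image_iff:
  fixes x :: "'i \<Rightarrow> 'a::metric_space"
  assumes "r > 0"
  shows "disconnected_graph (geometric_graph (x ` I) r) \<longleftrightarrow>
    I = {} \<or> (\<exists>J\<in>Pow I - {{}, I}. \<forall>i\<in>J. \<forall>j\<in>I - J. r \<le> dist (x i) (x j))"
  (is "_ \<longleftrightarrow> _ \<or> ?cut")
proof -
  have cut_indices: "?cut"
    if S: "S \<subseteq> x ` I" "S \<noteq> {}" "S \<noteq> x ` I" "\<forall>a\<in>S. \<forall>b\<in>x ` I - S. r \<le> dist a b" for S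
  proof (intro bexI[of _ "{i\<in>I. x i \<in> S}"] ballI)
    show "r \<le> dist (x i) (x j)" if "i \<in> {i\<in>I. x i \<in> S}" "j \<in> I - {i\<in>I. x i \<in> S}" for i j
      using S(4) that by simp
    show "{i\<in>I. x i \<in> S} \<in> Pow I - {{}, I}"
    proof -
      obtain a where "a \<in> S" using S(2) by blast
      with S(1) have "{i\<in>I. x i \<in> S} \<noteq> {}" by blast
      moreover have "{i\<in>I. x i \<in> S} \<noteq> I" using S(1,3) by blast
      ultimately show ?thesis by simp
    qed
  qed
  have cut_image: "\<exists>S\<subseteq>x ` I. S \<noteq> {} \<and> S \<noteq> x ` I \<and> (\<forall>a\<in>S. \<forall>b\<in>x ` I - S. r \<le> dist a b)"
    if J: "J \<in> Pow I - {{}, I}" "\<forall>i\<in>J. \<forall>j\<in>I - J. r \<le> dist (x i) (x j)" for J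
  proof (intro exI[of _ "x ` J"] conjI)
    obtain j where j: "j \<in> I - J" using J(1) by blast
    \<comment> \<open>Distinct indices may carry the same point; \<open>r > 0\<close> keeps such
      indices on the same side, so the image of \<open>J\<close> is still a proper subset.\<close>
    have "x j \<notin> x ` J"
    proof
      assume "x j \<in> x ` J"
      then obtain i where "i \<in> J" "x j = x i" by (rule imageE) auto
      with J(2) j have "r \<le> dist (x i) (x i)" by metis
      with assms show False by simp
    qed
    with j show "x ` J \<noteq> x ` I" by blast
  qed (use J in auto)
  have "(\<exists>S\<subseteq>x ` I. S \<noteq> {} \<and> S \<noteq> x ` I \<and> (\<forall>a\<in>S. \<forall>b\<in>x ` I - S. r \<le> dist a b)) \<longleftrightarrow> ?cut"
  proof
    assume "\<exists>S\<subseteq>x ` I. S \<noteq> {} \<and> S \<noteq> x ` I \<and> (\<forall>a\<in>S. \<forall>b\<in>x ` I - S. r \<le> dist a b)"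
    then show ?cut by (elim exE conjE) (rule cut_indices)
  next
    assume ?cut
    then show "\<exists>S\<subseteq>x ` I. S \<noteq> {} \<and> S \<noteq> x ` I \<and> (\<forall>a\<in>S. \<forall>b\<in>x ` I - S. r \<le> dist a b)"
      by (elim bexE) (rule cut_image)
  qed
  then show ?thesis
    unfolding disconnected_geometric_graph_iff image_is_empty by (rule arg_cong)
qed

text \<open>For each value \<open>n\<close> of the sample size the event is a finite combination of
  inequalities between measurable distances, and there are only countably many \<open>n\<close>.
  This is what allows passing to the complement of the event later.\<close>

lemma poisson_point_process_disconnected_measurable:
  assumes "poisson_point_process M t \<nu> P" "r > 0"
  shows "{\<omega> \<in> space M. disconnected_graph (geometric_graph (P \<omega>) r)} \<in> sets M"
proof -
  obtain N X where N[measurable]: "N \<in> measurable M (count_space (UNIV :: nat set))"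
    and X[measurable]: "\<And>i :: nat. X i \<in> borel_measurable M"
    and P: "\<And>\<omega>. \<omega> \<in> space M \<Longrightarrow> P \<omega> = (\<lambda>i. X i \<omega>) ` {..<N \<omega>}"
    using assms(1) unfolding poisson_point_process_def by blast
  have "{\<omega> \<in> space M. disconnected_graph (geometric_graph (P \<omega>) r)} =
      {\<omega> \<in> space M. \<exists>n. N \<omega> = n \<and> (n = 0 \<or>
        (\<exists>J\<in>Pow {..<n} - {{}, {..<n}}. \<forall>i\<in>J. \<forall>j\<in>{..<n} - J. r \<le> dist (X i \<omega>) (X j \<omega>)))}"
  proof (rule Collect_cong, rule conj_cong[OF refl])
    fix \<omega> assume "\<omega> \<in> space M"
    then show "disconnected_graph (geometric_graph (P \<omega>) r) \<longleftrightarrow>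
        (\<exists>n. N \<omega> = n \<and> (n = 0 \<or>
        (\<exists>J\<in>Pow {..<n} - {{}, {..<n}}. \<forall>i\<in>J. \<forall>j\<in>{..<n} - J. r \<le> dist (X i \<omega>) (X j \<omega>))))"
      unfolding P[OF \<open>\<omega> \<in> space M\<close>] disconnected_geometric_graph_image_iff[OF assms(2)]
      by (simp add: lessThan_empty_iff)
  qed
  also have "\<dots> \<in> sets M"
  proof -
    have [measurable]: "Measurable.pred M (\<lambda>\<omega>. \<exists>J\<in>Pow {..<n} - {{}, {..<n}}.
        \<forall>i\<in>J. \<forall>j\<in>{..<n} - J. r \<le> dist (X i \<omega>) (X j \<omega>))" for n :: nat
    proof (rule pred_intros_finite(4))
      fix J assume J: "J \<in> Pow {..<n} - {{}, {..<n}}"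
      then have "finite J" by (auto intro: finite_subset)
      then show "Measurable.pred M (\<lambda>\<omega>. \<forall>i\<in>J. \<forall>j\<in>{..<n} - J. r \<le> dist (X i \<omega>) (X j \<omega>))"
        by (intro pred_intros_finite(3)) auto
    qed auto
    show ?thesis by measurable
  qed
  finally show ?thesis .
qed

section \<open>Void probabilities of the Poisson process\<close>

lemma poisson_point_process_intensity:
  assumes "poisson_point_process M t \<nu> P"
  shows "prob_space \<nu>" "sets \<nu> = sets borel"
proof -
  obtain X :: "nat \<Rightarrow> _" where M: "prob_space M" and X: "X 0 \<in> borel_measurable M"
    and \<nu>: "\<nu> = distr M borel (X 0)"
    using assms unfolding poisson_point_process_def by metis
  show "prob_space \<nu>" unfolding \<nu> by (rule prob_space.prob_space_distr[OF M X])
  show "sets \<nu> = sets borel" unfolding \<nu> by simp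
qed

text \<open>Given \<open>N = k\<close>, all \<open>k\<close> points miss \<open>S\<close> with
  probability \<open>(1 - s) ^ k\<close>, where \<open>s\<close> is the mass of \<open>S\<close>.
  Weighting with the Poisson probabilities and summing over \<open>k\<close> gives an exponential
  series.\<close>

lemma poisson_void_probability:
  assumes "poisson_point_process M t \<nu> P" "S \<in> sets borel"
  shows "{\<omega> \<in> space M. P \<omega> \<inter> S = {}} \<in> sets M"
    and "measure M {\<omega> \<in> space M. P \<omega> \<inter> S = {}} = exp (- t * measure \<nu> S)"
proof -
  obtain N X where M: "prob_space M" "t > 0" and N[measurable]: "N \<in> measurable M (count_space (UNIV :: nat set))"
    and dN: "distr M (count_space UNIV) N = measure_pmf (poisson_pmf t)"
    and X[measurable]: "\<And>i :: nat. X i \<in> borel_measurable M"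
    and dX: "\<And>i. distr M borel (X i) = \<nu>"
    and indX: "prob_space.indep_vars M (\<lambda>_. borel) X UNIV"
    and indNX: "prob_space.indep_set M
          {N -` A \<inter> space M | A. A \<in> sets (count_space UNIV)}
          {(\<lambda>\<omega> i. X i \<omega>) -` B \<inter> space M | B. B \<in> sets (PiM UNIV (\<lambda>_. borel))}"
    and P: "\<And>\<omega>. \<omega> \<in> space M \<Longrightarrow> P \<omega> = (\<lambda>i. X i \<omega>) ` {..<N \<omega>}"
    using assms(1) unfolding poisson_point_process_def by blast
  interpret M: prob_space M by fact
  note [measurable] = assms(2)
  define s where "s = measure \<nu> S"
  define Z where "Z k = {\<omega> \<in> space M. \<forall>i<k. X i \<omega> \<notin> S}" for k
  have Z_meas[measurable]: "Z k \<in> sets M" for k unfolding Z_def by measurable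
  have miss: "M.prob (X i -` (- S) \<inter> space M) = 1 - s" for i
  proof -
    have "M.prob (X i -` (- S) \<inter> space M) = measure \<nu> (- S)"
      by (subst dX[symmetric, of i], subst measure_distr) auto
    also have "\<dots> = 1 - s"
    proof -
      interpret nu: prob_space \<nu> using assms(1) by (rule poisson_point_process_intensity)
      have "sets \<nu> = sets borel" using assms(1) by (rule poisson_point_process_intensity)
      note sp = this sets_eq_imp_space_eq[OF this]
      show ?thesis using nu.prob_compl[of S] sp assms(2)
        by (simp add: s_def Compl_eq_Diff_UNIV)
    qed
    finally show ?thesis .
  qed
  have pZ: "M.prob (Z k) = (1 - s) ^ k" for k
  \<comment> \<open>The product rule for independent variables asks for a nonempty index
    set.\<close>
  proof (cases "k = 0")
    case True
    then show ?thesis by (simp add: Z_def M.prob_space)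
  next
    case False
    have "Z k = (\<Inter>i\<in>{..<k}. X i -` (- S) \<inter> space M)"
      using False by (auto simp: Z_def)
    also have "M.prob \<dots> = (\<Prod>i<k. M.prob (X i -` (- S) \<inter> space M))"
      by (rule M.indep_varsD[OF indX]) (use False in auto)
    finally show ?thesis by (simp add: miss)
  qed
  have pN: "M.prob (N -` {k} \<inter> space M) = t ^ k / fact k * exp (- t)" for k
  proof -
    have "M.prob (N -` {k} \<inter> space M) = measure (distr M (count_space UNIV) N) {k}"
      by (subst measure_distr) auto
    then show ?thesis using M(2) by (simp add: dN measure_pmf_single)
  qed
  have pNZ: "M.prob ((N -` {k} \<inter> space M) \<inter> Z k) = t ^ k / fact k * exp (- t) * (1 - s) ^ k" for k
  proof -
    \<comment> \<open>Independence of \<open>N\<close> is assumed from the whole sequence of points,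
      so \<open>Z k\<close> has to be written as the preimage of a set in the product space.\<close>
    have "Z k = (\<lambda>\<omega> i. X i \<omega>) -` {f \<in> space (PiM UNIV (\<lambda>_. borel)). \<forall>i<k. f i \<notin> S} \<inter> space M"
      by (auto simp: Z_def space_PiM)
    moreover have "{f \<in> space (PiM UNIV (\<lambda>_. borel)). \<forall>i<k. f i \<notin> S} \<in> sets (PiM UNIV (\<lambda>_. borel))"
      by measurable
    ultimately have "M.prob ((N -` {k} \<inter> space M) \<inter> Z k) = M.prob (N -` {k} \<inter> space M) * M.prob (Z k)"
      by (intro M.indep_setD[OF indNX] CollectI exI[of _ "{k}"]
          exI[of _ "{f \<in> space (PiM UNIV (\<lambda>_. borel)). \<forall>i<k. f i \<notin> S}"] conjI) simp_all
    then show ?thesis by (simp add: pN pZ)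
  qed
  have eq: "{\<omega> \<in> space M. P \<omega> \<inter> S = {}} = (\<Union>k. (N -` {k} \<inter> space M) \<inter> Z k)"
  proof -
    have "P \<omega> \<inter> S = {} \<longleftrightarrow> (\<forall>i<N \<omega>. X i \<omega> \<notin> S)" if "\<omega> \<in> space M" for \<omega>
      unfolding P[OF that] by auto
    then show ?thesis by (auto simp: Z_def simp del: disjoint_iff)
  qed
  show "{\<omega> \<in> space M. P \<omega> \<inter> S = {}} \<in> sets M"
    unfolding eq by measurable
  have "(\<lambda>k. M.prob ((N -` {k} \<inter> space M) \<inter> Z k)) sums M.prob (\<Union>k. (N -` {k} \<inter> space M) \<inter> Z k)"
    by (rule M.finite_measure_UNION) (auto simp: disjoint_family_on_def)
  moreover have "(\<lambda>k. M.prob ((N -` {k} \<inter> space M) \<inter> Z k)) sums exp (- t * s)"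
  proof -
    have "(\<lambda>k. exp (- t) * ((t * (1 - s)) ^ k /\<^sub>R fact k)) sums (exp (- t) * exp (t * (1 - s)))"
      by (intro sums_mult exp_converges)
    moreover have "exp (- t) * exp (t * (1 - s)) = exp (- t * s)"
      by (simp flip: exp_add add: algebra_simps)
    moreover have "exp (- t) * ((t * (1 - s)) ^ k /\<^sub>R fact k) = t ^ k / fact k * exp (- t) * (1 - s) ^ k" for k
      by (simp only: power_mult_distrib) (simp add: field_simps)
    ultimately show ?thesis unfolding pNZ by simp
  qed
  ultimately show "measure M {\<omega> \<in> space M. P \<omega> \<inter> S = {}} = exp (- t * measure \<nu> S)"
    unfolding eq s_def by (rule sums_unique2)
qed

text \<open>Since the good-cell events are differences of void events, the product formula for
  disjoint cells follows from the void probabilities alone.\<close>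

lemma poisson_no_good_cell:
  fixes A B :: "'i \<Rightarrow> 'a::euclidean_space set"
  assumes P: "poisson_point_process M t \<nu> P" and "finite J"
    and "\<And>i. i \<in> J \<Longrightarrow> A i \<in> sets borel" "\<And>i. i \<in> J \<Longrightarrow> B i \<in> sets borel"
    and "\<And>i. i \<in> J \<Longrightarrow> A i \<inter> B i = {}"
    and "disjoint_family_on (\<lambda>i. A i \<union> B i) J"
    and "S \<in> sets borel" "\<And>i. i \<in> J \<Longrightarrow> S \<inter> (A i \<union> B i) = {}"
  defines "E \<equiv> \<lambda>J S. {\<omega> \<in> space M. P \<omega> \<inter> S = {} \<and> (\<forall>i\<in>J. \<not> (P \<omega> \<inter> A i = {} \<and> P \<omega> \<inter> B i \<noteq> {}))}"
  shows "E J S \<in> sets M \<and> measure M (E J S) = exp (- t * measure \<nu> S) *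
      (\<Prod>i\<in>J. 1 - exp (- t * measure \<nu> (A i)) * (1 - exp (- t * measure \<nu> (B i))))"
  using assms(2-8)
\<comment> \<open>The extra void set \<open>S\<close> exists for the induction: the hypothesis is
  applied to \<open>S\<close>, \<open>S \<union> A j\<close> and
  \<open>S \<union> A j \<union> B j\<close>.\<close>
proof (induction J arbitrary: S rule: finite_induct)
  case empty
  then show ?case
    using poisson_void_probability[OF P, of S] by (simp add: E_def)
next
  case (insert j J)
  interpret M: prob_space M using P unfolding poisson_point_process_def by blast
  interpret nu: prob_space \<nu> using P by (rule poisson_point_process_intensity)
  have sets_nu: "sets \<nu> = sets borel" using P by (rule poisson_point_process_intensity)
  let ?F = "\<Prod>i\<in>J. 1 - exp (- t * measure \<nu> (A i)) * (1 - exp (- t * measure \<nu> (B i)))"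
  have disj: "(A i \<union> B i) \<inter> (A j \<union> B j) = {}" if "i \<in> J" for i
    by (rule disjoint_family_onD[OF insert.prems(4)]) (use insert.hyps that in auto)
  have IH: "E J T \<in> sets M \<and> measure M (E J T) = exp (- t * measure \<nu> T) * ?F"
    if "T \<in> sets borel" "T \<subseteq> S \<union> A j \<union> B j" for T
  proof (rule insert.IH)
    show "disjoint_family_on (\<lambda>i. A i \<union> B i) J"
      by (rule disjoint_family_on_mono[OF _ insert.prems(4)]) auto
    show "T \<inter> (A i \<union> B i) = {}" if "i \<in> J" for i
      using disj[OF that] insert.prems(6)[of i] that \<open>T \<subseteq> _\<close> by blast
  qed (use insert.prems that in auto)
  have bor: "S \<in> sets borel" "A j \<in> sets borel" "B j \<in> sets borel"
    using insert.prems by auto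
  have cell: "S \<inter> A j = {}" "(S \<union> A j) \<inter> B j = {}"
    using insert.prems(3)[of j] insert.prems(6)[of j] by auto
  have nuA: "measure \<nu> (S \<union> A j) = measure \<nu> S + measure \<nu> (A j)"
    using bor cell by (intro nu.finite_measure_Union) (simp_all add: sets_nu)
  have nuB: "measure \<nu> (S \<union> A j \<union> B j) = measure \<nu> (S \<union> A j) + measure \<nu> (B j)"
    using bor cell by (intro nu.finite_measure_Union) (simp_all add: sets_nu)
  have I1: "E J S \<in> sets M \<and> measure M (E J S) = exp (- t * measure \<nu> S) * ?F"
    and I2: "E J (S \<union> A j) \<in> sets M \<and>
      measure M (E J (S \<union> A j)) = exp (- t * measure \<nu> (S \<union> A j)) * ?F"
    and I3: "E J (S \<union> A j \<union> B j) \<in> sets M \<and>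
      measure M (E J (S \<union> A j \<union> B j)) = exp (- t * measure \<nu> (S \<union> A j \<union> B j)) * ?F"
    using bor by (intro IH; auto)+
  \<comment> \<open>Cell \<open>j\<close> is good exactly when \<open>A j\<close> is void but
    \<open>A j \<union> B j\<close> is not, so the good configurations to be removed are a
    difference of two void events.\<close>
  have eq: "E (insert j J) S = E J S - (E J (S \<union> A j) - E J (S \<union> A j \<union> B j))"
    unfolding E_def Int_Un_distrib Un_empty ball_simps by fast
  have sub: "E J (S \<union> A j) \<subseteq> E J S" "E J (S \<union> A j \<union> B j) \<subseteq> E J (S \<union> A j)"
    unfolding E_def Int_Un_distrib Un_empty by fast+
  have m: "E J S \<in> sets M" "E J (S \<union> A j) \<in> sets M" "E J (S \<union> A j \<union> B j) \<in> sets M"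
    using I1 I2 I3 by simp_all
  \<comment> \<open>Here \<open>s\<close>, \<open>a\<close>, \<open>b\<close> stand for the void
    probabilities of \<open>S\<close>, \<open>A j\<close>, \<open>B j\<close>, and \<open>F\<close>
    for the product over \<open>J\<close>.\<close>
  have factor: "s * F - (s * a * F - s * a * b * F) = s * ((1 - a * (1 - b)) * F)"
    for s a b F :: real by algebra
  have "measure M (E (insert j J) S) =
      measure M (E J S) - (measure M (E J (S \<union> A j)) - measure M (E J (S \<union> A j \<union> B j)))"
  proof -
    have "measure M (E (insert j J) S) =
        measure M (E J S) - measure M (E J (S \<union> A j) - E J (S \<union> A j \<union> B j))"
      unfolding eq by (rule M.finite_measure_Diff) (use m sub in auto)
    then show ?thesis
      using M.finite_measure_Diff[OF m(2,3) sub(2)] by simp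
  qed
  also have "\<dots> = exp (- t * measure \<nu> S) * ?F -
      (exp (- t * measure \<nu> (S \<union> A j)) * ?F - exp (- t * measure \<nu> (S \<union> A j \<union> B j)) * ?F)"
    using I1 I2 I3 by simp_all
  also have "\<dots> = exp (- t * measure \<nu> S) * ((1 - exp (- t * measure \<nu> (A j)) * (1 - exp (- t * measure \<nu> (B j)))) * ?F)"
  proof -
    have e: "exp (- t * (a + b)) = exp (- t * a) * exp (- t * b)" for a b :: real
      by (simp add: distrib_left exp_diff exp_minus field_simps)
    show ?thesis unfolding nuB nuA e by (rule factor)
  qed
  also have "\<dots> = exp (- t * measure \<nu> S) *
      (\<Prod>i\<in>insert j J. 1 - exp (- t * measure \<nu> (A i)) * (1 - exp (- t * measure \<nu> (B i))))"
    using insert.hyps by simp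
  finally show ?case
    using m unfolding eq by simp
qed

section \<open>Local comparability of subexponential densities\<close>

text \<open>The Steinhaus-type argument behind the uniform convergence theorem: along a hypothetical
  bad sequence, the sets \<open>V n\<close> and \<open>u n + W n\<close> eventually have total measure
  more than 2 inside \<open>[0, 2]\<close>, hence they meet.\<close>

lemma increments_locally_bounded:
  fixes g :: "real \<Rightarrow> real"
  assumes [measurable]: "g \<in> borel_measurable borel"
    and lim: "\<And>u. ((\<lambda>x. g (x + u) - g x) \<longlongrightarrow> \<rho> * u) at_top"
  obtains D where "\<forall>\<^sub>F x in at_top. \<forall>u\<in>{0..1}. \<bar>g (x + u) - g x\<bar> \<le> D"
proof (rule ccontr)
  \<comment> \<open>This \<open>b\<close> exceeds the modulus of every limit
    \<open>\<rho> * l\<close> with \<open>l\<close> in \<open>[0, 2]\<close>. The bound refuted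
    below is \<open>2 * b\<close>, the sum of two increments smaller than \<open>b\<close>.\<close>
  define b where "b = 2 * \<bar>\<rho>\<bar> + 1"
  assume "\<not> thesis"
  then have "\<not> (\<forall>\<^sub>F x in at_top. \<forall>u\<in>{0..1}. \<bar>g (x + u) - g x\<bar> \<le> 2 * b)"
    using that by blast
  then have "\<forall>n::nat. \<exists>x u. real n \<le> x \<and> u \<in> {0..1} \<and> \<bar>g (x + u) - g x\<bar> > 2 * b"
    unfolding eventually_at_top_linorder by (meson not_le)
  then obtain x u where x: "\<And>n. real n \<le> x n" and u: "\<And>n. 0 \<le> u n" "\<And>n. u n \<le> 1"
    and bad: "\<And>n::nat. \<bar>g (x n + u n) - g (x n)\<bar> > 2 * b"
    unfolding atLeastAtMost_iff by metis
  have x_lim: "filterlim x at_top sequentially"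
    by (rule filterlim_at_top_mono[OF filterlim_real_sequentially]) (use x in auto)
  have bound: "\<exists>n. \<forall>m\<ge>n. \<bar>g (y m + l) - g (y m)\<bar> < b"
    if "filterlim y at_top sequentially" "0 \<le> l" "l \<le> 2" for y l
  proof -
    have "((\<lambda>m. g (y m + l) - g (y m)) \<longlongrightarrow> \<rho> * l) sequentially"
      by (rule filterlim_compose[OF lim that(1)])
    moreover have "\<bar>\<rho> * l\<bar> < b"
      using mult_left_mono[of l 2 "\<bar>\<rho>\<bar>"] that by (simp add: abs_mult b_def)
    ultimately have "\<forall>\<^sub>F m in sequentially. \<bar>g (y m + l) - g (y m)\<bar> < b"
      by (intro order_tendstoD(2)[OF tendsto_rabs])
    then show ?thesis by (simp add: eventually_sequentially)
  qed
  define V where "V n = {l \<in> {0..2}. \<forall>m\<ge>n. \<bar>g (x m + l) - g (x m)\<bar> < b}" for n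
  define W where "W n = {l \<in> {0..1}. \<forall>m\<ge>n. \<bar>g (x m + u m + l) - g (x m + u m)\<bar> < b}" for n
  have "V n \<in> sets borel" "W n \<in> sets borel" for n
    unfolding V_def W_def by measurable
  then have sets: "V n \<in> sets lebesgue" "W n \<in> sets lebesgue" for n
    by (simp_all add: sets_completionI_sets)
  have xu_lim: "filterlim (\<lambda>n. x n + u n) at_top sequentially"
    by (rule filterlim_at_top_mono[OF x_lim]) (use u in auto)
  have V: "(\<Union>n. V n) = {0..2}"
  proof (intro equalityI subsetI)
    fix l :: real assume l: "l \<in> {0..2}"
    then obtain n where "\<forall>m\<ge>n. \<bar>g (x m + l) - g (x m)\<bar> < b" using bound[OF x_lim, of l] by auto
    with l show "l \<in> (\<Union>n. V n)" unfolding V_def by blast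
  qed (auto simp: V_def)
  have W: "(\<Union>n. W n) = {0..1}"
  proof (intro equalityI subsetI)
    fix l :: real assume l: "l \<in> {0..1}"
    then obtain n where "\<forall>m\<ge>n. \<bar>g (x m + u m + l) - g (x m + u m)\<bar> < b"
      using bound[OF xu_lim, of l] by auto
    with l show "l \<in> (\<Union>n. W n)" unfolding W_def by blast
  qed (auto simp: W_def)
  have range: "V n \<subseteq> {0..2}" "W n \<subseteq> {0..1}" for n
    unfolding V_def W_def by blast+
  have incseq: "incseq V" "incseq W"
    unfolding incseq_def V_def W_def using order_trans by blast+
  have "(\<lambda>n. measure lebesgue (V n)) \<longlonglongrightarrow> measure lebesgue (\<Union>n. V n)"
    by (rule Lim_measure_incseq) (use sets incseq in \<open>auto simp: V\<close>)
  then have "\<forall>\<^sub>F n in sequentially. measure lebesgue (V n) > 3 / 2"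
    by (intro order_tendstoD(1)) (auto simp: V)
  moreover have "(\<lambda>n. measure lebesgue (W n)) \<longlonglongrightarrow> measure lebesgue (\<Union>n. W n)"
    by (rule Lim_measure_incseq) (use sets incseq in \<open>auto simp: W\<close>)
  then have "\<forall>\<^sub>F n in sequentially. measure lebesgue (W n) > 1 / 2"
    by (intro order_tendstoD(1)) (auto simp: W)
  ultimately have "\<forall>\<^sub>F n in sequentially. measure lebesgue (V n) > 3 / 2 \<and> measure lebesgue (W n) > 1 / 2"
    by (rule eventually_conj)
  then obtain n where n: "measure lebesgue (V n) > 3 / 2" "measure lebesgue (W n) > 1 / 2"
    using eventually_happens'[OF sequentially_bot] by blast
  have fin: "V n \<in> lmeasurable" "W n \<in> lmeasurable"
    using sets[of n] range[of n]
    by (auto intro!: bounded_set_imp_lmeasurable intro: bounded_subset[OF bounded_closed_interval])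
  have fin': "(+) (u n) ` W n \<in> lmeasurable"
    by (rule measurable_translation[OF fin(2)])
  have "V n \<inter> (+) (u n) ` W n \<noteq> {}"
  proof
    assume disj: "V n \<inter> (+) (u n) ` W n = {}"
    have "measure lebesgue (V n \<union> (+) (u n) ` W n) =
        measure lebesgue (V n) + measure lebesgue ((+) (u n) ` W n)"
      by (rule measure_Union)
        (use disj fmeasurableD2[OF fin(1)] fmeasurableD2[OF fin'] fin fin' in \<open>simp_all add: fmeasurableD\<close>)
    then have "measure lebesgue (V n \<union> (+) (u n) ` W n) = measure lebesgue (V n) + measure lebesgue (W n)"
      by (simp add: measure_translation)
    moreover have "measure lebesgue (V n \<union> (+) (u n) ` W n) \<le> measure lebesgue {0..2::real}"
    proof (rule measure_mono_fmeasurable)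
      show "V n \<union> (+) (u n) ` W n \<subseteq> {0..2}"
      proof (intro Un_least image_subsetI)
        fix l assume "l \<in> W n"
        with range(2)[of n] have "0 \<le> l" "l \<le> 1" by auto
        with u(1,2)[of n] show "u n + l \<in> {0..2}" by simp
      qed (rule range)
    qed (use fin fin' in auto)
    ultimately show False using n by simp
  qed
  then obtain l where l: "l \<in> W n" "u n + l \<in> V n" by blast
  \<comment> \<open>Both increments end at the same point \<open>x n + u n + l\<close>, so their
    difference is the increment from \<open>x n\<close> to \<open>x n + u n\<close>, which
    contradicts \<open>bad\<close>.\<close>
  have "\<bar>g (x n + (u n + l)) - g (x n)\<bar> < b" "\<bar>g (x n + u n + l) - g (x n + u n)\<bar> < b"
    using l unfolding V_def W_def by blast+
  with bad[of n] show False by (simp add: add.assoc)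
qed

text \<open>The width 2 is enough for balls of radius at most 2 and for consecutive integer radii.
  Exchanging \<open>r\<close> and \<open>s\<close> gives the reverse bound with the same
  constant.\<close>

definition locally_comparable :: "(real \<Rightarrow> real) \<Rightarrow> bool" where
  "locally_comparable f \<longleftrightarrow>
     (\<exists>C R0. \<forall>r\<ge>R0. \<forall>s\<ge>R0. \<bar>r - s\<bar> \<le> 2 \<longrightarrow> f r \<le> C * f s)"

text \<open>On the logarithmic scale regular variation says that the increments of
  \<open>g x = ln (f (exp x))\<close> converge, hence they are bounded uniformly over shifts in
  \<open>[0, 1]\<close>. For \<open>r \<ge> 2\<close> the step from \<open>r\<close> to
  \<open>s \<le> r + 2\<close> at most doubles \<open>r\<close>, so it is a logarithmic shift of at
  most 1. Measurability only concerns \<open>f\<close> on the positive half-line.\<close>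

lemma locally_comparable_regularly_varying:
  assumes rv: "regularly_varying \<alpha> f" and meas: "(\<lambda>x. f (exp x)) \<in> borel_measurable borel"
  shows "locally_comparable f"
proof -
  have pos: "f r > 0" if "r > 0" for r using rv that by (auto simp: regularly_varying_def)
  define g where "g x = ln (f (exp x))" for x
  have "g \<in> borel_measurable borel"
    unfolding g_def using meas by measurable
  moreover have "((\<lambda>x. g (x + u) - g x) \<longlongrightarrow> \<alpha> * u) at_top" for u
  proof -
    have "((\<lambda>R. f (exp u * R) / f R) \<longlongrightarrow> exp u powr \<alpha>) at_top"
      using rv by (simp add: regularly_varying_def)
    then have "((\<lambda>x. f (exp u * exp x) / f (exp x)) \<longlongrightarrow> exp u powr \<alpha>) at_top"
      by (rule filterlim_compose[OF _ exp_at_top])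
    then have "((\<lambda>x. ln (f (exp u * exp x) / f (exp x))) \<longlongrightarrow> ln (exp u powr \<alpha>)) at_top"
      by (rule tendsto_ln) simp
    moreover have "ln (f (exp u * exp x) / f (exp x)) = g (x + u) - g x" for x
      using pos[of "exp x"] pos[of "exp u * exp x"]
      by (simp add: g_def ln_div exp_add mult.commute)
    ultimately show ?thesis by (simp add: ln_powr)
  qed
  ultimately obtain D where "\<forall>\<^sub>F x in at_top. \<forall>u\<in>{0..1}. \<bar>g (x + u) - g x\<bar> \<le> D"
    by (rule increments_locally_bounded)
  then obtain X where X: "\<And>x u. x \<ge> X \<Longrightarrow> 0 \<le> u \<Longrightarrow> u \<le> 1 \<Longrightarrow> \<bar>g (x + u) - g x\<bar> \<le> D"
    unfolding eventually_at_top_linorder by (auto simp: Ball_def)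
  have close: "\<bar>ln (f r) - ln (f s)\<bar> \<le> D" if "r \<ge> max 2 (exp X)" "r \<le> s" "s \<le> r + 2" for r s
  proof -
    have "ln (s / r) \<le> 1"
    proof -
      have "s / r \<le> 2" using that by (simp add: field_simps)
      then have "s / r \<le> exp 1" using exp_ge_add_one_self[of 1] by linarith
      then show ?thesis using that ln_le_cancel_iff[of "s / r" "exp 1"] by simp
    qed
    moreover have "X \<le> ln r"
      using that by (subst ln_ge_iff) auto
    moreover have "ln (s / r) \<ge> 0"
      using that by simp
    ultimately have "\<bar>g (ln r + ln (s / r)) - g (ln r)\<bar> \<le> D"
      by (intro X)
    moreover have "ln r + ln (s / r) = ln s"
      using that by (simp add: ln_div)
    ultimately show ?thesis
      using that by (simp add: g_def abs_minus_commute)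
  qed
  show ?thesis
    unfolding locally_comparable_def
  proof (rule exI[of _ "exp D"], rule exI[of _ "max 2 (exp X)"], intro allI impI)
    fix r s assume rs: "max 2 (exp X) \<le> r" "max 2 (exp X) \<le> s" "\<bar>r - s\<bar> \<le> 2"
    have "\<bar>ln (f r) - ln (f s)\<bar> \<le> D"
      using close[of r s] close[of s r] rs by (cases "r \<le> s") (auto simp: abs_minus_commute)
    then have "ln (f r) \<le> ln (exp D * f s)"
      using pos[of s] rs by (simp add: ln_mult)
    then show "f r \<le> exp D * f s"
      using pos[of s] pos[of r] rs by simp
  qed
qed

lemma locally_comparable_mult:
  assumes "locally_comparable f" "locally_comparable g"
    and "\<And>x. x > 0 \<Longrightarrow> f x > 0" "\<And>x. x > 0 \<Longrightarrow> g x > 0"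
  shows "locally_comparable (\<lambda>x. f x * g x)"
proof -
  obtain C R D S where C: "\<And>r s. r \<ge> R \<Longrightarrow> s \<ge> R \<Longrightarrow> \<bar>r - s\<bar> \<le> 2 \<Longrightarrow> f r \<le> C * f s"
    and D: "\<And>r s. r \<ge> S \<Longrightarrow> s \<ge> S \<Longrightarrow> \<bar>r - s\<bar> \<le> 2 \<Longrightarrow> g r \<le> D * g s"
    using assms(1,2) unfolding locally_comparable_def by metis
  show ?thesis
    unfolding locally_comparable_def
  proof (rule exI[of _ "C * D"], rule exI[of _ "max 1 (max R S)"], intro allI impI)
    fix r s assume rs: "max 1 (max R S) \<le> r" "max 1 (max R S) \<le> s" "\<bar>r - s\<bar> \<le> 2"
    have "f r * g r \<le> (C * f s) * (D * g s)"
    proof (rule mult_mono)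
      show "f r \<le> C * f s" "g r \<le> D * g s" using C D rs by auto
      then show "0 \<le> C * f s" using assms(3)[of r] rs by simp
      show "0 \<le> g r" using assms(4)[of r] rs by simp
    qed
    then show "f r * g r \<le> C * D * (f s * g s)" by (simp add: mult_ac)
  qed
qed

text \<open>A nondecreasing \<open>\<psi>'\<close> would make \<open>\<psi>\<close> grow at least linearly, in the sense that
  \<open>\<psi> (2 * R) \<ge> 2 * \<psi> R - const\<close>, which is impossible for an index below 1.\<close>

lemma locally_comparable_exp_minus_von_mises:
  assumes vm: "von_mises \<psi>"
    and mon: "mono_on {z0..} (deriv \<psi>) \<or> antimono_on {z0..} (deriv \<psi>)"
    and rv: "regularly_varying v \<psi>" and "v < 1"
  shows "locally_comparable (\<lambda>r. exp (- \<psi> r))"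
proof -
  obtain \<psi>1 where d1: "\<And>z. z \<ge> 0 \<Longrightarrow> (\<psi> has_real_derivative \<psi>1 z) (at z within {0..})"
    using vm unfolding von_mises_def C2_on_nonneg_def by blast
  have d: "(\<psi> has_real_derivative deriv \<psi> z) (at z)" if "z > 0" for z
  proof -
    \<comment> \<open>At interior points the one-sided derivative is two-sided, so
      \<open>deriv\<close> is the true derivative there.\<close>
    have "at z within {0..} = at z"
      using that by (intro at_within_interior) simp
    with d1[of z] that have "(\<psi> has_real_derivative \<psi>1 z) (at z)" by simp
    then show ?thesis by (simp add: DERIV_imp_deriv)
  qed
  have mvt: "\<exists>z. a < z \<and> z < b \<and> \<psi> b - \<psi> a = (b - a) * deriv \<psi> z" if "0 < a" "a < b" for a b
    using MVT2[of a b \<psi> "deriv \<psi>"] d that by auto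
  obtain z1 where z1: "\<And>z. z \<ge> z1 \<Longrightarrow> deriv \<psi> z > 0"
    using vm unfolding von_mises_def eventually_at_top_linorder by blast
  define a where "a = max 1 (max z0 z1)"
  have a: "a > 0" "a \<ge> z0" "a \<ge> z1" by (auto simp: a_def)
  have pos: "\<psi> z > 0" if "z > 0" for z using rv that by (simp add: regularly_varying_def)
  have "\<not> mono_on {z0..} (deriv \<psi>)"
  proof
    assume m: "mono_on {z0..} (deriv \<psi>)"
    have grow: "2 - \<psi> a / \<psi> R \<le> \<psi> (2 * R) / \<psi> R" if R: "R > a" for R
    proof -
      \<comment> \<open>The interval from \<open>a\<close> to \<open>R\<close> is shorter than the
        one from \<open>R\<close> to \<open>2 * R\<close> and has the smaller slope, so its
        increment of \<open>\<psi>\<close> is at most that of the second.\<close>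
      obtain z where z: "a < z" "z < R" "\<psi> R - \<psi> a = (R - a) * deriv \<psi> z"
        using mvt[of a R] R a by auto
      obtain w where w: "R < w" "w < 2 * R" "\<psi> (2 * R) - \<psi> R = (2 * R - R) * deriv \<psi> w"
        using mvt[of R "2 * R"] R a by auto
      have "deriv \<psi> z \<le> deriv \<psi> w"
        using m z w a R by (auto simp: mono_on_def)
      then have "(R - a) * deriv \<psi> z \<le> R * deriv \<psi> w"
        using z1[of z] z w a R by (intro mult_mono) auto
      then have "2 * \<psi> R - \<psi> a \<le> \<psi> (2 * R)"
        using z w by (simp add: algebra_simps)
      then have "(2 * \<psi> R - \<psi> a) / \<psi> R \<le> \<psi> (2 * R) / \<psi> R"
        using pos[of R] R a by (intro divide_right_mono) auto
      then show ?thesis using pos[of R] R a by (simp add: diff_divide_distrib)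
    qed
    have "((\<lambda>R. \<psi> a / \<psi> R) \<longlongrightarrow> 0) at_top"
      using vm by (intro tendsto_divide_0[OF tendsto_const] filterlim_at_top_imp_at_infinity)
        (auto simp: von_mises_def)
    then have "((\<lambda>R. 2 - \<psi> a / \<psi> R) \<longlongrightarrow> 2 - 0) at_top"
      by (intro tendsto_intros)
    moreover have "((\<lambda>R. \<psi> (2 * R) / \<psi> R) \<longlongrightarrow> 2 powr v) at_top"
      using rv by (simp add: regularly_varying_def)
    moreover have "\<forall>\<^sub>F R in at_top. 2 - \<psi> a / \<psi> R \<le> \<psi> (2 * R) / \<psi> R"
      using eventually_gt_at_top[of a] by eventually_elim (rule grow)
    ultimately have "2 - 0 \<le> (2::real) powr v"
      by (intro tendsto_le[OF trivial_limit_at_top_linorder])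
    moreover have "(2::real) powr v < 2 powr 1"
      using \<open>v < 1\<close> by (intro powr_less_mono) auto
    ultimately show False by simp
  qed
  then have am: "antimono_on {z0..} (deriv \<psi>)" using mon by blast
  \<comment> \<open>With \<open>\<psi>'\<close> nonincreasing and positive from \<open>a\<close> on,
    its value at \<open>a\<close> is a Lipschitz constant for \<open>\<psi>\<close> there.\<close>
  define c where "c = deriv \<psi> a"
  have inc: "\<bar>\<psi> s - \<psi> r\<bar> \<le> 2 * c" if rs: "a \<le> r" "r < s" "s \<le> r + 2" for r s
  proof -
    obtain z where z: "r < z" "z < s" "\<psi> s - \<psi> r = (s - r) * deriv \<psi> z"
      using mvt[of r s] rs a by auto
    have "deriv \<psi> z \<le> c"
      using am z a rs unfolding c_def monotone_on_def by auto
    then have "(s - r) * deriv \<psi> z \<le> 2 * c"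
      using z1[of z] z a rs by (intro mult_mono) auto
    moreover have "0 \<le> (s - r) * deriv \<psi> z"
      using z1[of z] z a rs by simp
    ultimately show ?thesis using z by simp
  qed
  have "c > 0" using z1 a by (simp add: c_def)
  show ?thesis
    unfolding locally_comparable_def
  proof (rule exI[of _ "exp (2 * c)"], rule exI[of _ a], intro allI impI)
    fix r s assume rs: "a \<le> r" "a \<le> s" "\<bar>r - s\<bar> \<le> 2"
    have "\<bar>\<psi> s - \<psi> r\<bar> \<le> 2 * c"
      using inc[of r s] inc[of s r] rs \<open>c > 0\<close>
      by (cases r s rule: linorder_cases) (auto simp: abs_minus_commute)
    then show "exp (- \<psi> r) \<le> exp (2 * c) * exp (- \<psi> s)"
      by (simp flip: exp_add)
  qed
qed

text \<open>A heavy tail has a regularly varying profile. A light tail is the product of the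
  regularly varying \<open>L\<close> and of \<open>exp (- \<psi>)\<close>, and comparability passes
  to products.\<close>

lemma subexponential_decay_comparable:
  fixes q :: "'a::euclidean_space \<Rightarrow> real"
  assumes sub: "subexponential_decay q" and rad: "radial q"
    and meas: "q \<in> borel_measurable borel"
  shows "\<exists>C R0. \<forall>x y. norm x \<ge> R0 \<longrightarrow> norm y \<ge> R0 \<longrightarrow> \<bar>norm x - norm y\<bar> \<le> 2 \<longrightarrow> q x \<le> C * q y"
proof -
  \<comment> \<open>Restricting \<open>q\<close> to the ray through \<open>e\<close> makes its
    profile measurable.\<close>
  obtain e :: 'a where e: "norm e = 1" using nonempty_Basis norm_Basis by blast
  have "(\<lambda>x. exp x *\<^sub>R e) \<in> borel_measurable borel"
    by (intro borel_measurable_continuous_onI continuous_intros)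
  then have ray: "(\<lambda>x. q (exp x *\<^sub>R e)) \<in> borel_measurable borel"
    using meas by (rule measurable_compose)
  have "\<exists>f. (\<forall>x. q x = f (norm x)) \<and> locally_comparable f"
    using sub unfolding subexponential_decay_def
  proof (elim disjE exE conjE)
    assume "heavy_tail q"
    then obtain \<alpha> where rv: "regularly_varying (- \<alpha>) (radial_profile q)"
      by (auto simp: heavy_tail_def)
    have q: "q x = radial_profile q (norm x)" for x
    proof -
      have "norm (SOME y :: 'a. norm y = norm x) = norm x" by (rule someI[of _ x]) (rule refl)
      then show ?thesis using rad unfolding radial_def radial_profile_def by metis
    qed
    have "(\<lambda>x. radial_profile q (exp x)) \<in> borel_measurable borel"
      using ray by (simp add: q[of "_ *\<^sub>R _"] e)
    with rv q show ?thesis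
      using locally_comparable_regularly_varying by blast
  next
    fix L \<psi> v assume lt: "light_tail_with q L \<psi>" and v: "0 < v" "v < 1" "regularly_varying v \<psi>"
    have q: "\<And>x. q x = L (norm x) * exp (- \<psi> (norm x))" and vm: "von_mises \<psi>"
      using lt by (auto simp: light_tail_with_def)
    obtain z0 \<alpha> where mon: "mono_on {z0..} (deriv \<psi>) \<or> antimono_on {z0..} (deriv \<psi>)"
      and L: "regularly_varying \<alpha> L"
      using lt unfolding light_tail_with_def by blast
    obtain \<psi>1 where "\<And>z. z \<ge> 0 \<Longrightarrow> (\<psi> has_real_derivative \<psi>1 z) (at z within {0..})"
      using vm unfolding von_mises_def C2_on_nonneg_def by blast
    then have "continuous_on {0..} \<psi>"
      by (intro DERIV_continuous_on[where D = \<psi>1]) simp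
    then have "continuous_on UNIV (\<lambda>x. \<psi> (exp x))"
      by (rule continuous_on_compose2) (auto intro!: continuous_intros)
    then have [measurable]: "(\<lambda>x. \<psi> (exp x)) \<in> borel_measurable borel"
      by (rule borel_measurable_continuous_onI)
    \<comment> \<open>No measurability of \<open>L\<close> is assumed; it is recovered by
      multiplying \<open>q\<close> along the ray by \<open>exp \<psi>\<close>.\<close>
    have "(\<lambda>x. q (exp x *\<^sub>R e) * exp (\<psi> (exp x))) \<in> borel_measurable borel"
      using ray by measurable
    moreover have "q (exp x *\<^sub>R e) * exp (\<psi> (exp x)) = L (exp x)" for x
      by (simp add: q e exp_minus)
    ultimately have "locally_comparable L"
      using locally_comparable_regularly_varying[OF L] by simp
    then have "locally_comparable (\<lambda>r. L r * exp (- \<psi> r))"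
      using locally_comparable_exp_minus_von_mises[OF vm mon v(3,2)] L
      by (intro locally_comparable_mult) (auto simp: regularly_varying_def)
    with q show ?thesis by (intro exI[of _ "\<lambda>r. L r * exp (- \<psi> r)"]) simp
  qed
  then show ?thesis
    unfolding locally_comparable_def by metis
qed

section \<open>Separated cells at the critical radius\<close>

lemma measure_density_bounds:
  fixes q :: "'a::euclidean_space \<Rightarrow> real"
  assumes prob: "prob_space (density lborel (\<lambda>x. ennreal (q x)))"
    and q[measurable]: "q \<in> borel_measurable borel"
    and B[measurable]: "B \<in> sets borel" and "bounded B"
    and "0 \<le> a" "0 \<le> b" and bounds: "\<And>x. x \<in> B \<Longrightarrow> a \<le> q x" "\<And>x. x \<in> B \<Longrightarrow> q x \<le> b"
  shows "a * measure lborel B \<le> measure (density lborel (\<lambda>x. ennreal (q x))) B"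
    and "measure (density lborel (\<lambda>x. ennreal (q x))) B \<le> b * measure lborel B"
proof -
  let ?\<nu> = "density lborel (\<lambda>x. ennreal (q x))"
  interpret prob_space ?\<nu> by fact
  have fin: "emeasure lborel B = ennreal (measure lborel B)"
    using emeasure_bounded_finite[OF \<open>bounded B\<close>] by (intro emeasure_eq_ennreal_measure) simp
  have const: "(\<integral>\<^sup>+x. ennreal c * indicator B x \<partial>lborel) = ennreal (c * measure lborel B)"
    if "0 \<le> c" for c
    using that by (simp add: nn_integral_cmult_indicator fin ennreal_mult)
  have dens: "ennreal (measure ?\<nu> B) = (\<integral>\<^sup>+x. ennreal (q x) * indicator B x \<partial>lborel)"
    unfolding emeasure_eq_measure[symmetric] by (rule emeasure_density) simp_all
  have "(\<integral>\<^sup>+x. ennreal a * indicator B x \<partial>lborel) \<le> (\<integral>\<^sup>+x. ennreal (q x) * indicator B x \<partial>lborel)"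
    by (intro nn_integral_mono) (auto simp: indicator_def intro!: ennreal_leI bounds)
  then show "a * measure lborel B \<le> measure ?\<nu> B"
    unfolding dens[symmetric] const[OF \<open>0 \<le> a\<close>] by simp
  have "(\<integral>\<^sup>+x. ennreal (q x) * indicator B x \<partial>lborel) \<le> (\<integral>\<^sup>+x. ennreal b * indicator B x \<partial>lborel)"
    by (intro nn_integral_mono) (auto simp: indicator_def intro!: ennreal_leI bounds)
  then show "measure ?\<nu> B \<le> b * measure lborel B"
    unfolding dens[symmetric] const[OF \<open>0 \<le> b\<close>] using \<open>0 \<le> b\<close> by simp
qed

text \<open>Take the least \<open>k \<ge> m\<close> with \<open>n * p k \<le> 1\<close>. The product
  at its predecessor still exceeds 1, and one step loses at most the factor \<open>C\<close>. This
  provides the radius at which \<open>n * q\<close> has order 1.\<close>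

lemma eventually_balanced_index:
  fixes p :: "nat \<Rightarrow> real"
  assumes pos: "\<And>k. p k > 0" and "p \<longlonglongrightarrow> 0" and step: "\<And>k. k \<ge> m \<Longrightarrow> p k \<le> C * p (Suc k)"
  shows "\<forall>\<^sub>F n in sequentially. \<exists>k\<ge>m. real n * p k \<le> 1 \<and> 1 \<le> C * (real n * p k)"
proof -
  have "filterlim (\<lambda>n. p m * real n) at_top sequentially"
    by (rule filterlim_tendsto_pos_mult_at_top[OF tendsto_const pos filterlim_real_sequentially])
  then have "\<forall>\<^sub>F n in sequentially. 1 < p m * real n"
    unfolding filterlim_at_top_dense by blast
  then show ?thesis
  proof eventually_elim
    case (elim n)
    let ?Q = "\<lambda>k. k \<ge> m \<and> real n * p k \<le> 1"
    have "n > 0" using elim by (cases n) simp_all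
    then have "\<forall>\<^sub>F k in sequentially. p k < 1 / real n"
      using assms(2) by (intro order_tendstoD(2)) auto
    moreover have "\<forall>\<^sub>F k in sequentially. k \<ge> m" by (rule eventually_ge_at_top)
    ultimately have "\<forall>\<^sub>F k in sequentially. ?Q k"
      by eventually_elim (use \<open>n > 0\<close> in \<open>simp add: field_simps\<close>)
    then obtain k0 where "?Q k0"
      using eventually_happens'[OF sequentially_bot] by blast
    define k where "k = (LEAST k. ?Q k)"
    have k: "?Q k" unfolding k_def by (rule LeastI) fact
    \<comment> \<open>For large \<open>n\<close> the product at \<open>m\<close> exceeds 1, so the
      predecessor of \<open>k\<close> is still at least \<open>m\<close> and \<open>step\<close>
      applies to it.\<close>
    with elim have "k \<noteq> m" by (auto simp: mult.commute)
    with k obtain j where j: "k = Suc j" "j \<ge> m" by (cases k) auto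
    have "\<not> ?Q j" using not_less_Least[of j ?Q] j unfolding k_def by simp
    with j have "1 < real n * p j" by simp
    also have "\<dots> \<le> real n * (C * p k)"
      unfolding j(1) by (intro mult_left_mono step j) simp
    finally have "1 \<le> C * (real n * p k)" by (simp add: mult_ac)
    with k show ?case by blast
  qed
qed

text \<open>The centres lie on a circle in a coordinate plane, with second coordinates
  \<open>4 * i\<close>; this coordinate alone separates them. The lower bound on \<open>R\<close>
  keeps the square root real.\<close>

lemma separated_points_on_sphere:
  fixes R :: real
  assumes "DIM('a::euclidean_space) \<ge> 2" and R: "R \<ge> 4 * real K"
  obtains c :: "nat \<Rightarrow> 'a::euclidean_space" where "\<And>i. i < K \<Longrightarrow> norm (c i) = R"
    and "\<And>i j. i < K \<Longrightarrow> j < K \<Longrightarrow> i \<noteq> j \<Longrightarrow> dist (c i) (c j) \<ge> 4"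
proof -
  obtain E :: "'a set" where "E \<subseteq> Basis" "card E = 2"
    using obtain_subset_with_card_n[OF assms(1)] by metis
  moreover from this(2) obtain e1 e2 where "E = {e1, e2}" "e1 \<noteq> e2"
    unfolding card_2_iff by blast
  ultimately have e: "e1 \<in> Basis" "e2 \<in> Basis" "e1 \<noteq> e2" by simp_all
  define c where "c i = sqrt (R\<^sup>2 - (4 * real i)\<^sup>2) *\<^sub>R e1 + (4 * real i) *\<^sub>R e2" for i :: nat
  have "norm (c i) = R" if "i < K" for i
  proof -
    have "(4 * real i)\<^sup>2 \<le> R\<^sup>2" using that R by (intro power_mono) auto
    then have "c i \<bullet> c i = R\<^sup>2"
      using e by (simp add: c_def inner_simps inner_Basis power2_eq_square[symmetric])
    then have "(norm (c i))\<^sup>2 = R\<^sup>2" by (simp add: power2_norm_eq_inner)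
    moreover have "R \<ge> 0" using R by (rule order_trans[rotated]) simp
    ultimately show ?thesis by (simp add: power2_eq_iff_nonneg)
  qed
  moreover have "dist (c i) (c j) \<ge> 4" if "i \<noteq> j" for i j
  proof -
    have "(c i - c j) \<bullet> e2 = 4 * (real i - real j)"
      using e by (simp add: c_def inner_simps inner_Basis)
    moreover have "\<bar>real i - real j\<bar> \<ge> 1" using that by linarith
    ultimately have "4 \<le> \<bar>(c i - c j) \<bullet> e2\<bar>" by (simp add: abs_mult)
    also have "\<dots> \<le> dist (c i) (c j)"
      unfolding dist_norm by (rule Basis_le_norm) fact
    finally show ?thesis .
  qed
  ultimately show thesis using that by blast
qed

lemma dist_ge_if_ball_outside_ball:
  fixes x y z :: "'a::metric_space"
  assumes "x \<in> ball z (1 / 2)" "y \<notin> ball z (3 / 2)"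
  shows "1 \<le> dist x y"
  using dist_triangle[of z y x] assms by simp

text \<open>The \<open>2 * K\<close> cells are split into two batches of size \<open>K\<close>. A
  good cell in each batch gives two distinct good cells, and a batch without any has probability at
  most the \<open>K\<close>-th power on the left. The radii 1/2 and 3/2 differ by the connection
  distance 1.\<close>

lemma poisson_disconnected_bound:
  fixes c :: "nat \<Rightarrow> 'a::euclidean_space"
  assumes P: "poisson_point_process M t \<nu> P"
    and sep: "\<And>i j. i < 2 * K \<Longrightarrow> j < 2 * K \<Longrightarrow> i \<noteq> j \<Longrightarrow> dist (c i) (c j) \<ge> 4"
    and outer: "\<And>i. i < 2 * K \<Longrightarrow> t * measure \<nu> (ball (c i) (3 / 2) - ball (c i) (1 / 2)) \<le> a"
    and inner: "\<And>i. i < 2 * K \<Longrightarrow> b \<le> t * measure \<nu> (ball (c i) (1 / 2))"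
    and "0 \<le> b"
  shows "1 - 2 * (1 - exp (- a) * (1 - exp (- b))) ^ K \<le>
    measure M {\<omega> \<in> space M. disconnected_graph (geometric_graph (P \<omega>) 1)}"
proof -
  interpret M: prob_space M using P unfolding poisson_point_process_def by blast
  have t: "t > 0" using P unfolding poisson_point_process_def by blast
  define A where "A i = ball (c i) (3 / 2) - ball (c i) (1 / 2)" for i
  define B where "B i = ball (c i) (1 / 2)" for i
  define good where "good \<omega> i \<longleftrightarrow> P \<omega> \<inter> A i = {} \<and> P \<omega> \<inter> B i \<noteq> {}" for \<omega> i
  define bad where "bad J = {\<omega> \<in> space M. \<forall>i\<in>J. \<not> good \<omega> i}" for J
  let ?\<rho> = "1 - exp (- a) * (1 - exp (- b))"
  have AB: "A i \<union> B i = ball (c i) (3 / 2)" for i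
    unfolding A_def B_def using subset_ball[of "1 / 2" "3 / 2" "c i"] by auto
  have disj: "(A i \<union> B i) \<inter> (A j \<union> B j) = {}" if "i < 2 * K" "j < 2 * K" "i \<noteq> j" for i j
    unfolding AB using sep[OF that] by (intro disjoint_ballI) simp
  have bad: "bad J \<in> sets M" "measure M (bad J) \<le> ?\<rho> ^ card J" if J: "J \<subseteq> {..<2 * K}" for J
  proof -
    let ?F = "\<Prod>i\<in>J. 1 - exp (- t * measure \<nu> (A i)) * (1 - exp (- t * measure \<nu> (B i)))"
    have "{\<omega> \<in> space M. P \<omega> \<inter> {} = {} \<and> (\<forall>i\<in>J. \<not> (P \<omega> \<inter> A i = {} \<and> P \<omega> \<inter> B i \<noteq> {}))} \<in> sets M \<and>
      measure M {\<omega> \<in> space M. P \<omega> \<inter> {} = {} \<and> (\<forall>i\<in>J. \<not> (P \<omega> \<inter> A i = {} \<and> P \<omega> \<inter> B i \<noteq> {}))} =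
        exp (- t * measure \<nu> {}) * ?F"
    proof (rule poisson_no_good_cell[OF P])
      show "finite J" using J by (rule finite_subset) simp
      show "disjoint_family_on (\<lambda>i. A i \<union> B i) J"
        unfolding disjoint_family_on_def using disj J by blast
    qed (auto simp: A_def B_def)
    then have *: "bad J \<in> sets M \<and> measure M (bad J) = ?F"
      by (simp only: bad_def good_def Int_empty_right simp_thms measure_empty mult_zero_right
          exp_zero mult_1)
    then show "bad J \<in> sets M" by simp
    have "?F \<le> (\<Prod>i\<in>J. ?\<rho>)"
    proof (intro prod_mono conjI)
      fix i assume "i \<in> J"
      then have i: "i < 2 * K" using J by auto
      have e: "exp (- a) \<le> exp (- t * measure \<nu> (A i))" "exp (- t * measure \<nu> (B i)) \<le> exp (- b)"
        using outer[OF i] inner[OF i] by (simp_all add: A_def B_def)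
      have le1: "exp (- t * measure \<nu> (A i)) \<le> 1" "exp (- t * measure \<nu> (B i)) \<le> 1"
        using t by simp_all
      have "exp (- a) * (1 - exp (- b)) \<le> exp (- t * measure \<nu> (A i)) * (1 - exp (- t * measure \<nu> (B i)))"
        using e \<open>0 \<le> b\<close> by (intro mult_mono) simp_all
      then show "1 - exp (- t * measure \<nu> (A i)) * (1 - exp (- t * measure \<nu> (B i))) \<le> ?\<rho>"
        by simp
      have "exp (- t * measure \<nu> (A i)) * (1 - exp (- t * measure \<nu> (B i))) \<le> 1 * 1"
        using le1 by (intro mult_mono) simp_all
      then show "0 \<le> 1 - exp (- t * measure \<nu> (A i)) * (1 - exp (- t * measure \<nu> (B i)))"
        by simp
    qed
    with * show "measure M (bad J) \<le> ?\<rho> ^ card J" by simp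
  qed
  \<comment> \<open>The points in the inner ball of cell \<open>i\<close> are one side of the cut. A
    single good cell might contain all of \<open>P \<omega>\<close>; the point \<open>y\<close> in
    cell \<open>j\<close> makes the cut proper.\<close>
  have disc: "disconnected_graph (geometric_graph (P \<omega>) 1)"
    if ij: "i < 2 * K" "j < 2 * K" "i \<noteq> j" "good \<omega> i" "good \<omega> j" for \<omega> i j
  proof -
    let ?S = "P \<omega> \<inter> B i"
    obtain y where y: "y \<in> P \<omega>" "y \<in> B j" using ij(5) unfolding good_def by blast
    have "\<forall>x\<in>?S. \<forall>z\<in>P \<omega> - ?S. 1 \<le> dist x z"
    proof (intro ballI)
      fix x z assume x: "x \<in> ?S" and z: "z \<in> P \<omega> - ?S"
      have "z \<notin> A i \<union> B i" using z ij(4) unfolding good_def by blast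
      then have "z \<notin> ball (c i) (3 / 2)" by (simp only: AB not_False_eq_True)
      with x show "1 \<le> dist x z"
        by (intro dist_ge_if_ball_outside_ball[of _ "c i"]) (simp_all add: B_def)
    qed
    moreover have "?S \<noteq> {}" using ij(4) unfolding good_def by simp
    moreover have "y \<notin> B i" using disj[OF ij(1-3)] y by blast
    then have "?S \<noteq> P \<omega>" using y by blast
    ultimately show ?thesis
      unfolding disconnected_geometric_graph_iff by (intro disjI2 exI[of _ ?S] conjI) simp_all
  qed
  let ?D = "{\<omega> \<in> space M. disconnected_graph (geometric_graph (P \<omega>) 1)}"
  have D: "?D \<in> sets M"
    using P by (rule poisson_point_process_disconnected_measurable) simp
  have cover: "space M - ?D \<subseteq> bad {..<K} \<union> bad {K..<2 * K}"
  proof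
    fix \<omega> assume \<omega>: "\<omega> \<in> space M - ?D"
    show "\<omega> \<in> bad {..<K} \<union> bad {K..<2 * K}"
    proof (rule ccontr)
      assume "\<omega> \<notin> bad {..<K} \<union> bad {K..<2 * K}"
      then obtain i j where "i < K" "good \<omega> i" "K \<le> j" "j < 2 * K" "good \<omega> j"
        using \<omega> unfolding bad_def by auto
      with disc[of i j \<omega>] \<omega> show False by simp
    qed
  qed
  have sub: "{..<K} \<subseteq> {..<2 * K}" "{K..<2 * K} \<subseteq> {..<2 * K}" by auto
  have "1 - measure M ?D = measure M (space M - ?D)"
    using M.prob_compl[OF D] by simp
  also have "\<dots> \<le> measure M (bad {..<K} \<union> bad {K..<2 * K})"
    using cover bad(1)[OF sub(1)] bad(1)[OF sub(2)] by (intro M.finite_measure_mono) auto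
  also have "\<dots> \<le> measure M (bad {..<K}) + measure M (bad {K..<2 * K})"
    using bad(1)[OF sub(1)] bad(1)[OF sub(2)] by (rule measure_Un_le)
  also have "\<dots> \<le> ?\<rho> ^ K + ?\<rho> ^ K"
    using bad(2)[OF sub(1)] bad(2)[OF sub(2)] by simp
  finally show ?thesis by simp
qed

theorem theorem4p1:
  fixes q :: "'a::euclidean_space \<Rightarrow> real"
    and M :: "nat \<Rightarrow> 'w measure"
    and P :: "nat \<Rightarrow> 'w \<Rightarrow> 'a set"
  assumes "DIM('a) \<ge> 2"
    and "q \<in> borel_measurable borel"
    and "\<And>x. q x > 0"
    and "prob_space (density lborel (\<lambda>x. ennreal (q x)))"
    and "radial q"
    and "subexponential_decay q"
    and "\<And>n. n \<ge> 1 \<Longrightarrow>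
      poisson_point_process (M n) (real n) (density lborel (\<lambda>x. ennreal (q x))) (P n)"
  shows "(\<lambda>n. \<P>(\<omega> in M n. disconnected_graph (geometric_graph (P n \<omega>) 1))) \<longlonglongrightarrow> 1"
proof -
  let ?\<nu> = "density lborel (\<lambda>x. ennreal (q x))"
  let ?p = "\<lambda>n. \<P>(\<omega> in M n. disconnected_graph (geometric_graph (P n \<omega>) 1))"
  interpret nu: prob_space ?\<nu> by fact
  obtain C R0 where comp: "\<And>x y. norm x \<ge> R0 \<Longrightarrow> norm y \<ge> R0 \<Longrightarrow> \<bar>norm x - norm y\<bar> \<le> 2 \<Longrightarrow> q x \<le> C * q y"
    using subexponential_decay_comparable[OF assms(6,5,2)] by metis
  obtain e :: 'a where e: "norm e = 1" using nonempty_Basis norm_Basis by blast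
  define p where "p k = q (real k *\<^sub>R e)" for k
  have p_pos: "p k > 0" for k using assms(3) by (simp add: p_def)
  \<comment> \<open>A point is compared with itself; the absolute value makes its norm at least
    \<open>R0\<close>.\<close>
  have "1 \<le> C"
    using comp[of "\<bar>R0\<bar> *\<^sub>R e" "\<bar>R0\<bar> *\<^sub>R e"] assms(3)[of "\<bar>R0\<bar> *\<^sub>R e"] e abs_ge_self[of R0] by simp
  then have "C > 0" by simp
  define vol where "vol r = measure lborel (ball (0 :: 'a) r)" for r
  have vol: "measure lborel (ball z r) = vol r" if "0 \<le> r" for z :: 'a and r
    using that by (simp add: vol_def content_ball)
  have vol_pos: "vol r > 0" if "r > 0" for r
    unfolding vol_def using that by (rule content_ball_pos)
  \<comment> \<open>Comparability depends on norms only, so \<open>p k\<close>, sampled on a single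
    ray, controls the mass of balls around every point of norm \<open>k\<close>.\<close>
  have cell: "p k / C * vol r \<le> measure ?\<nu> (ball z r)" "measure ?\<nu> (ball z r) \<le> C * p k * vol r"
    if k: "real k \<ge> R0 + 2" and z: "norm z = real k" and r: "0 \<le> r" "r \<le> 2" for k r z
  proof -
    have q: "p k / C \<le> q x" "q x \<le> C * p k" if x: "x \<in> ball z r" for x
    proof -
      have "\<bar>norm x - norm z\<bar> \<le> dist z x"
        using norm_triangle_ineq3[of x z] by (simp add: dist_norm norm_minus_commute)
      also have "\<dots> \<le> 2" using x r by simp
      finally have d: "\<bar>norm x - real k\<bar> \<le> 2" using z by simp
      then have n: "norm x \<ge> R0" "real k \<ge> R0" using k by auto
      show "q x \<le> C * p k"
        unfolding p_def using n d e by (intro comp) simp_all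
      have "p k \<le> C * q x"
        unfolding p_def using n d e by (intro comp) (simp_all add: abs_minus_commute)
      then show "p k / C \<le> q x" using \<open>C > 0\<close> by (simp add: field_simps)
    qed
    show "p k / C * vol r \<le> measure ?\<nu> (ball z r)" "measure ?\<nu> (ball z r) \<le> C * p k * vol r"
      using measure_density_bounds[OF assms(4,2), of "ball z r" "p k / C" "C * p k"] q
        \<open>C > 0\<close> p_pos[of k] vol[OF r(1)]
      by (simp_all add: less_imp_le)
  qed
  \<comment> \<open>The unit ball around \<open>real k *\<^sub>R e\<close> lies outside radius
    \<open>k - 1\<close>, and its mass dominates a fixed multiple of \<open>p k\<close>, while the
    tail mass of a probability measure vanishes. The truncated \<open>k - 1\<close> at
    \<open>k = 0\<close> is harmless.\<close>
  have "p \<longlonglongrightarrow> 0"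
  proof -
    have "(\<lambda>k. measure ?\<nu> {x. norm x \<ge> real k}) \<longlonglongrightarrow> measure ?\<nu> (\<Inter>k. {x. norm x \<ge> real k})"
      by (rule nu.finite_Lim_measure_decseq) (auto simp: decseq_def)
    moreover have "(\<Inter>k. {x :: 'a. norm x \<ge> real k}) = {}"
    proof -
      have "\<exists>k. \<not> norm x \<ge> real k" for x :: 'a
        using reals_Archimedean2[of "norm x"] by (auto simp: not_le)
      then show ?thesis by blast
    qed
    ultimately have "(\<lambda>k. measure ?\<nu> {x. norm x \<ge> real k}) \<longlonglongrightarrow> 0" by simp
    then have "(\<lambda>k. C / vol 1 * measure ?\<nu> {x. norm x \<ge> real (k - 1)}) \<longlonglongrightarrow> C / vol 1 * 0"
      by (intro tendsto_mult_left) (rule filterlim_compose[OF _ filterlim_minus_const_nat_at_top])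
    then have lim: "(\<lambda>k. C / vol 1 * measure ?\<nu> {x. norm x \<ge> real (k - 1)}) \<longlonglongrightarrow> 0" by simp
    have "\<forall>\<^sub>F k in sequentially. real k \<ge> R0 + 2"
      using filterlim_real_sequentially unfolding filterlim_at_top by blast
    then have "\<forall>\<^sub>F k in sequentially. norm (p k) \<le> C / vol 1 * measure ?\<nu> {x. norm x \<ge> real (k - 1)}"
    proof eventually_elim
      case (elim k)
      have "ball (real k *\<^sub>R e) 1 \<subseteq> {x. norm x \<ge> real (k - 1)}"
      proof
        fix x assume "x \<in> ball (real k *\<^sub>R e) 1"
        then show "x \<in> {x. norm x \<ge> real (k - 1)}"
          using norm_triangle_ineq2[of "real k *\<^sub>R e" x] e by (cases k) (auto simp: dist_norm)
      qed
      then have "measure ?\<nu> (ball (real k *\<^sub>R e) 1) \<le> measure ?\<nu> {x. norm x \<ge> real (k - 1)}"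
        by (intro nu.finite_measure_mono) auto
      with cell(1)[of k "real k *\<^sub>R e" 1] elim e
      have "p k / C * vol 1 \<le> measure ?\<nu> {x. norm x \<ge> real (k - 1)}" by simp
      then show ?case
        using \<open>C > 0\<close> vol_pos[of 1] p_pos[of k] by (simp add: field_simps)
    qed
    then show ?thesis by (rule Lim_null_comparison) (rule lim)
  qed
  \<comment> \<open>These are the bounds for the expected numbers of points in shell and inner ball
    when \<open>1 / C \<le> n * p k \<le> 1\<close>. In \<open>b\<close> one division by
    \<open>C\<close> comes from comparability, the other from this balance. Neither \<open>a\<close>
    nor \<open>b\<close> depends on \<open>n\<close> or \<open>K\<close>, hence neither does
    \<open>\<rho>\<close>.\<close>
  define a where "a = C * vol (3 / 2)"
  define b where "b = vol (1 / 2) / C / C"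
  define \<rho> where "\<rho> = 1 - exp (- a) * (1 - exp (- b))"
  have "b > 0" using vol_pos[of "1 / 2"] \<open>C > 0\<close> by (simp add: b_def)
  have "a > 0" using vol_pos[of "3 / 2"] \<open>C > 0\<close> by (simp add: a_def)
  have bound: "\<forall>\<^sub>F n in sequentially. 1 - 2 * \<rho> ^ K \<le> ?p n" for K
  proof -
    \<comment> \<open>The margin 2 keeps the balls inside the region of comparability, and
      \<open>8 * K\<close> is the radius needed for \<open>2 * K\<close> separated centres.\<close>
    define m where "m = nat \<lceil>max (R0 + 2) (8 * real K)\<rceil>"
    have m: "real m \<ge> R0 + 2" "real m \<ge> 8 * real K"
      unfolding m_def using real_nat_ceiling_ge[of "max (R0 + 2) (8 * real K)"] by linarith+
    have "p k \<le> C * p (Suc k)" if "k \<ge> m" for k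
      unfolding p_def using that m e by (intro comp) auto
    then have "\<forall>\<^sub>F n in sequentially. \<exists>k\<ge>m. real n * p k \<le> 1 \<and> 1 \<le> C * (real n * p k)"
      by (intro eventually_balanced_index p_pos \<open>p \<longlonglongrightarrow> 0\<close>)
    with eventually_ge_at_top[of 1] show ?thesis
    proof eventually_elim
      case (elim n)
      then obtain k where k: "k \<ge> m" "real n * p k \<le> 1" "1 \<le> C * (real n * p k)" by blast
      have kR: "real k \<ge> R0 + 2" "real k \<ge> 4 * real (2 * K)" using m k(1) by auto
      obtain c :: "nat \<Rightarrow> 'a" where c: "\<And>i. i < 2 * K \<Longrightarrow> norm (c i) = real k"
        "\<And>i j. i < 2 * K \<Longrightarrow> j < 2 * K \<Longrightarrow> i \<noteq> j \<Longrightarrow> dist (c i) (c j) \<ge> 4"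
        using separated_points_on_sphere[OF assms(1) kR(2)] by blast
      show ?case
        unfolding \<rho>_def
      proof (rule poisson_disconnected_bound[OF assms(7)[OF elim(1)] c(2)])
        fix i assume i: "i < 2 * K"
        have "measure ?\<nu> (ball (c i) (3 / 2) - ball (c i) (1 / 2)) \<le> measure ?\<nu> (ball (c i) (3 / 2))"
          by (intro nu.finite_measure_mono) auto
        also have "\<dots> \<le> C * p k * vol (3 / 2)"
          by (rule cell(2)[OF kR(1) c(1)[OF i]]) auto
        finally have "real n * measure ?\<nu> (ball (c i) (3 / 2) - ball (c i) (1 / 2)) \<le>
            real n * (C * p k * vol (3 / 2))"
          by (rule mult_left_mono) simp
        also have "\<dots> = (real n * p k) * a" by (simp add: a_def)
        also have "\<dots> \<le> 1 * a" using k(2) \<open>a > 0\<close> by (intro mult_right_mono) auto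
        finally show "real n * measure ?\<nu> (ball (c i) (3 / 2) - ball (c i) (1 / 2)) \<le> a" by simp
        have "b * 1 \<le> b * (C * (real n * p k))"
          using k(3) \<open>b > 0\<close> by (intro mult_left_mono) auto
        also have "\<dots> = real n * (p k / C * vol (1 / 2))"
          using \<open>C > 0\<close> by (simp add: b_def field_simps)
        also have "\<dots> \<le> real n * measure ?\<nu> (ball (c i) (1 / 2))"
          by (intro mult_left_mono cell(1)[OF kR(1) c(1)[OF i]]) auto
        finally show "b \<le> real n * measure ?\<nu> (ball (c i) (1 / 2))" by simp
      qed (use \<open>b > 0\<close> in auto)
    qed
  qed
  have "0 \<le> \<rho>" "\<rho> < 1"
  proof -
    have "exp (- a) * (1 - exp (- b)) \<le> 1 * 1"
      using \<open>a > 0\<close> \<open>b > 0\<close> by (intro mult_mono) auto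
    then show "0 \<le> \<rho>" by (simp add: \<rho>_def)
    show "\<rho> < 1" using \<open>b > 0\<close> by (simp add: \<rho>_def)
  qed
  show ?thesis
  proof (rule LIMSEQ_I)
    fix \<epsilon> :: real assume "\<epsilon> > 0"
    \<comment> \<open>The number of cells is fixed first, from \<epsilon> alone; only then does
      \<open>n\<close> tend to infinity.\<close>
    have "(\<lambda>K. 2 * \<rho> ^ K) \<longlonglongrightarrow> 2 * 0"
      using \<open>0 \<le> \<rho>\<close> \<open>\<rho> < 1\<close> by (intro tendsto_mult_left LIMSEQ_realpow_zero)
    then have "\<forall>\<^sub>F K in sequentially. 2 * \<rho> ^ K < \<epsilon>"
      using \<open>\<epsilon> > 0\<close> by (intro order_tendstoD(2)) auto
    then obtain K where K: "2 * \<rho> ^ K < \<epsilon>"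
      using eventually_happens'[OF sequentially_bot] by blast
    have "\<forall>\<^sub>F n in sequentially. norm (?p n - 1) < \<epsilon>"
      using bound[of K] eventually_ge_at_top[of 1]
    proof eventually_elim
      case (elim n)
      then have "prob_space (M n)" using assms(7) by (auto simp: poisson_point_process_def)
      then have "?p n \<le> 1" by (rule prob_space.prob_le_1)
      with elim(1) K show ?case by simp
    qed
    then show "\<exists>n0. \<forall>n\<ge>n0. norm (?p n - 1) < \<epsilon>"
      by (simp add: eventually_sequentially)
  qed
qed

end
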